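(* The Horowitz–Shelah maximal eventually different family $\mathcal{E} \subseteq {}^{\omega}\mathrm{Seq}$ is not square; that is, $\mathcal{E}^2$ is not a maximal eventually different family in ${}^{\omega}(\mathrm{Seq}\times\mathrm{Seq})$.
   Context: For countable sets $A,B$ and $f,g \in {}^{A}B$ (functions from $A$ to $B$) let $E(f,g) := \{a \in A \mid f(a) = g(a)\}$; $f$ and $g$ are eventually different if $E(f,g)$ is finite. A family $\mathcal{F} \subseteq {}^{A}B$ is eventually different (ed) if its members are pairwise eventually different, and it is maximal eventually different (med) if it is maximal with respect to inclusion among ed families contained in ${}^{A}B$. With $(f_1\times f_2)(a) := (f_1(a),f_2(a))$, put $\mathcal{F}^2 := \{f_1\times f_2 \mid f_1,f_2\in\mathcal{F}\} \subseteq {}^{A}(B^2)$. A med family $\mathcal{F}$ is square ($2$-productive) if $\mathcal{F}^2$ is med. Definition of $\mathcal{E}$. Let $\mathrm{Seq} := {}^{<\omega}\omega$ be the set of finite sequences of natural numbers, and let $\mathrm{lh}(s)$ be the length of $s\in\mathrm{Seq}$. Fix a computable bijection $\Phi: {}^{\omega}\mathrm{Seq} \to {}^{\omega}\omega$ with computable inverse, and a computable (injective) coding $\langle\cdot\rangle$ of finite sequences of members of $\mathrm{Seq}$ by natural numbers. For $f \in {}^{\omega}\omega$ let $\mathrm{e}(f) \in {}^{\omega}\mathrm{Seq}$ be $\mathrm{e}(f)(n) := f \restriction n$. For $h \in {}^{\omega}\mathrm{Seq}$ let $B(h) := \{2\langle h\restriction n\rangle + 1 \mid n \in \omega\}$.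 Define a relation $\prec_h$ on $B(h)$ by: $m \prec_h m'$ iff $m<m'$, $\mathrm{lh}(h(m)) = m$, $\mathrm{lh}(h(m')) = m'$ and $h(m) \subsetneq h(m')$ (proper initial segment). Let $T(h) := \{m \in B(h) \mid \text{for all } m' \in B(h) \text{ with } m' \geq m: m \not\prec_h m'\}$. Let $C(h) := T(h)$ if $T(h)$ is infinite and $C(h) := \emptyset$ otherwise. For $C\subseteq\omega$ define $\dot{\mathrm{e}}(h,C) \in {}^\omega\mathrm{Seq}$ by $\dot{\mathrm{e}}(h,C)(n) := h(n)$ if $n \in C$ and $\dot{\mathrm{e}}(h,C)(n) := \mathrm{e}(\Phi(h))(n)$ otherwise. Then $\mathcal{E} := \{\dot{\mathrm{e}}(h, C(h)) \mid h \in {}^{\omega}\mathrm{Seq}\}$, which is known to be a med family in ${}^{\omega}\mathrm{Seq}$. *)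

theory Defs
  imports Complex_Main "HOL-Library.Sublist" "HOL-Library.Nat_Bijection" "HOL-Library.Countable"
begin

text \<open>Countable sets \<open>A\<close>, \<open>B\<close> are rendered as countable types, so that the functions from \<open>A\<close> to
  \<open>B\<close> are exactly the elements of the function type.\<close>

definition agreement :: "('a::countable \<Rightarrow> 'b::countable) \<Rightarrow> ('a \<Rightarrow> 'b) \<Rightarrow> 'a set" where
  "agreement f g = {a. f a = g a}"

definition eventually_different :: "('a::countable \<Rightarrow> 'b::countable) \<Rightarrow> ('a \<Rightarrow> 'b) \<Rightarrow> bool" where
  "eventually_different f g \<longleftrightarrow> finite (agreement f g)"

definition ed_family :: "('a::countable \<Rightarrow> 'b::countable) set \<Rightarrow> bool" where
  "ed_family F \<longleftrightarrow> pairwise eventually_different F"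

definition med_family :: "('a::countable \<Rightarrow> 'b::countable) set \<Rightarrow> bool" where
  "med_family F \<longleftrightarrow> ed_family F \<and> (\<forall>G. ed_family G \<and> F \<subseteq> G \<longrightarrow> G = F)"

definition fun_prod :: "('a \<Rightarrow> 'b) \<Rightarrow> ('a \<Rightarrow> 'c) \<Rightarrow> 'a \<Rightarrow> 'b \<times> 'c" where
  "fun_prod f1 f2 = (\<lambda>a. (f1 a, f2 a))"

definition family_square :: "('a \<Rightarrow> 'b) set \<Rightarrow> ('a \<Rightarrow> 'b \<times> 'b) set" where
  "family_square F = {fun_prod f1 f2 | f1 f2. f1 \<in> F \<and> f2 \<in> F}"

definition square_family :: "('a::countable \<Rightarrow> 'b::countable) set \<Rightarrow> bool" where
  "square_family F \<longleftrightarrow> med_family F \<and> med_family (family_square F)"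


text \<open>Computability relative to an oracle, via the partial recursive functions:
  \<open>rec_eval g p xs y\<close> means that the program \<open>p\<close> with oracle \<open>g\<close> halts on the argument list \<open>xs\<close>
  with value \<open>y\<close>.\<close>

datatype recfn = Zero | Succ | Proj nat | Oracle
  | Comp recfn "recfn list" | PrimRec recfn recfn | Mu recfn

inductive rec_eval :: "(nat \<Rightarrow> nat) \<Rightarrow> recfn \<Rightarrow> nat list \<Rightarrow> nat \<Rightarrow> bool" for g where
  zero: "rec_eval g Zero xs 0"
| succ: "rec_eval g Succ [x] (Suc x)"
| proj: "i < length xs \<Longrightarrow> rec_eval g (Proj i) xs (xs ! i)"
| orac: "rec_eval g Oracle [x] (g x)"
| comp: "list_all2 (\<lambda>q y. rec_eval g q xs y) qs ys \<Longrightarrow> rec_eval g p ys z \<Longrightarrow>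
    rec_eval g (Comp p qs) xs z"
| prim_0: "rec_eval g p xs y \<Longrightarrow> rec_eval g (PrimRec p q) (0 # xs) y"
| prim_Suc: "rec_eval g (PrimRec p q) (n # xs) y \<Longrightarrow> rec_eval g q (y # n # xs) z \<Longrightarrow>
    rec_eval g (PrimRec p q) (Suc n # xs) z"
| mu: "rec_eval g p (n # xs) 0 \<Longrightarrow> (\<forall>m<n. \<exists>y. rec_eval g p (m # xs) (Suc y)) \<Longrightarrow>
    rec_eval g (Mu p) xs n"

text \<open>Computability of total operators between \<open>\<^sup>\<omega>Seq\<close> and \<open>\<^sup>\<omega>\<omega>\<close>: a single program computes every
  value of the output from the input given as an oracle. Finite sequences are represented by
  numbers through the computable bijection \<^const>\<open>list_encode\<close>.\<close>

type_synonym seq = "nat list"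

definition computable_from_seqs :: "((nat \<Rightarrow> seq) \<Rightarrow> (nat \<Rightarrow> nat)) \<Rightarrow> bool" where
  "computable_from_seqs F \<longleftrightarrow>
     (\<exists>p. \<forall>h n. rec_eval (\<lambda>k. list_encode (h k)) p [n] (F h n))"

definition computable_to_seqs :: "((nat \<Rightarrow> nat) \<Rightarrow> (nat \<Rightarrow> seq)) \<Rightarrow> bool" where
  "computable_to_seqs G \<longleftrightarrow>
     (\<exists>p. \<forall>f n. rec_eval f p [n] (list_encode (G f n)))"

text \<open>For functions on finite objects the oracle is a fixed trivial one.\<close>

definition computable_coding :: "(seq list \<Rightarrow> nat) \<Rightarrow> bool" where
  "computable_coding c \<longleftrightarrow>
     (\<exists>p. \<forall>s. rec_eval (\<lambda>_. 0) p [list_encode (map list_encode s)] (c s))"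


text \<open>The Horowitz--Shelah family, relative to the coding \<open>c\<close> of finite sequences of members of
  \<open>Seq\<close> and the bijection \<open>\<Phi>\<close>.\<close>

definition restr :: "(nat \<Rightarrow> 'a) \<Rightarrow> nat \<Rightarrow> 'a list" where
  "restr f n = map f [0..<n]"

definition hs_e :: "(nat \<Rightarrow> nat) \<Rightarrow> nat \<Rightarrow> seq" where
  "hs_e f n = restr f n"

definition hs_B :: "(seq list \<Rightarrow> nat) \<Rightarrow> (nat \<Rightarrow> seq) \<Rightarrow> nat set" where
  "hs_B c h = {2 * c (restr h n) + 1 | n. True}"

definition hs_prec :: "(seq list \<Rightarrow> nat) \<Rightarrow> (nat \<Rightarrow> seq) \<Rightarrow> nat \<Rightarrow> nat \<Rightarrow> bool" where
  "hs_prec c h m m' \<longleftrightarrow> m \<in> hs_B c h \<and> m' \<in> hs_B c h \<and> m < m' \<and>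
     length (h m) = m \<and> length (h m') = m' \<and> strict_prefix (h m) (h m')"

definition hs_T :: "(seq list \<Rightarrow> nat) \<Rightarrow> (nat \<Rightarrow> seq) \<Rightarrow> nat set" where
  "hs_T c h = {m \<in> hs_B c h. \<forall>m' \<in> hs_B c h. m' \<ge> m \<longrightarrow> \<not> hs_prec c h m m'}"

definition hs_C :: "(seq list \<Rightarrow> nat) \<Rightarrow> (nat \<Rightarrow> seq) \<Rightarrow> nat set" where
  "hs_C c h = (if infinite (hs_T c h) then hs_T c h else {})"

definition hs_edot ::
  "((nat \<Rightarrow> seq) \<Rightarrow> (nat \<Rightarrow> nat)) \<Rightarrow> (nat \<Rightarrow> seq) \<Rightarrow> nat set \<Rightarrow> nat \<Rightarrow> seq" where
  "hs_edot \<Phi> h C n = (if n \<in> C then h n else hs_e (\<Phi> h) n)"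

definition hs_family ::
  "((nat \<Rightarrow> seq) \<Rightarrow> (nat \<Rightarrow> nat)) \<Rightarrow> (seq list \<Rightarrow> nat) \<Rightarrow> (nat \<Rightarrow> seq) set" where
  "hs_family \<Phi> c = {hs_edot \<Phi> h (hs_C c h) | h. True}"

end

theory Submission
  imports Defs
begin

text \<open>
  A med family leaves no function eventually different from all its members, so it suffices to
  find \<open>p, q\<close> from \<open>\<omega>\<close> to \<open>Seq\<close> such that \<open>p \<times> q\<close> agrees only finitely often with
  each \<open>f\<^sub>1 \<times> f\<^sub>2\<close>, for \<open>f\<^sub>1, f\<^sub>2\<close> in the Horowitz--Shelah family.

  Outside of \<open>C(h)\<close>, the member given by \<open>h\<close> takes at \<open>n\<close> a value of length \<open>n\<close>. If
  \<open>p(n)\<close> and \<open>q(n)\<close> never have length \<open>n\<close>, then \<open>p\<close> can meet the member given by \<open>h\<^sub>1\<close>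
  only inside \<open>C(h\<^sub>1)\<close>, hence inside \<open>B(h\<^sub>1)\<close>, and likewise for \<open>q\<close> and \<open>h\<^sub>2\<close>. The sets
  \<open>B(h\<^sub>1)\<close> and \<open>B(h\<^sub>2)\<close> consist of codes of initial segments, so they are almost disjoint
  unless \<open>h\<^sub>1 = h\<^sub>2\<close>. In the remaining case one and the same function would have to agree at \<open>n\<close>
  with both \<open>p\<close> and \<open>q\<close>, which is excluded by taking \<open>p(n) \<noteq> q(n)\<close> for every \<open>n\<close>. The
  constant sequences of length \<open>n + 1\<close> with values \<open>0\<close> and \<open>1\<close> meet all these demands.
\<close>

text \<open>Maximality in the form in which it gets refuted. The domain has to be infinite: only then is
  a function not eventually different from itself, hence outside of the family that it extends.\<close>

lemma med_family_meets_every_function: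
  fixes g :: "'a::countable \<Rightarrow> 'b::countable"
  assumes "infinite (UNIV :: 'a set)" and med: "med_family F"
  shows "\<exists>f\<in>F. infinite (agreement f g)"
proof (rule ccontr)
  assume "\<not> (\<exists>f\<in>F. infinite (agreement f g))"
  then have fin: "finite (agreement f g)" "finite (agreement g f)" if "f \<in> F" for f
    using that by (auto simp: agreement_def eq_commute)
  have "ed_family (insert g F)"
    using med fin
    by (auto simp: med_family_def ed_family_def pairwise_insert eventually_different_def)
  then have "g \<in> F"
    using med unfolding med_family_def by blast
  then have "finite (agreement g g)"
    by (rule fin)
  then show False
    using assms(1) by (simp add: agreement_def)
qed

text \<open>A common element codes a common initial segment, whose length is at most the first place
  where the two functions differ.\<close>

lemma finite_hs_B_inter:
  assumes "inj c" and "h1 \<noteq> h2"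
  shows "finite (hs_B c h1 \<inter> hs_B c h2)"
proof -
  obtain k where k: "h1 k \<noteq> h2 k"
    using assms(2) by auto
  have "hs_B c h1 \<inter> hs_B c h2 \<subseteq> (\<lambda>n. 2 * c (restr h1 n) + 1) ` {..k}"
  proof
    fix m assume "m \<in> hs_B c h1 \<inter> hs_B c h2"
    then obtain i j where m: "m = 2 * c (restr h1 i) + 1" "m = 2 * c (restr h2 j) + 1"
      unfolding hs_B_def by blast
    then have eq: "restr h1 i = restr h2 j"
      using assms(1) by (simp add: inj_eq)
    then have "i = j"
      by (metis diff_zero length_map length_upt restr_def)
    with eq have "\<forall>l<i. h1 l = h2 l"
      by (auto simp: restr_def)
    with k have "i \<le> k"
      using not_less by blast
    then show "m \<in> (\<lambda>n. 2 * c (restr h1 n) + 1) ` {..k}"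
      using m(1) by simp
  qed
  then show ?thesis
    by (rule finite_subset) simp
qed

text \<open>The values copied from \<open>\<Phi> h\<close> have length exactly \<open>n\<close>, so any other length betrays a value
  copied from \<open>h\<close> itself.\<close>

lemma hs_edot_length_neq_imp_mem_hs_B:
  assumes "length (hs_edot \<Phi> h (hs_C c h) n) \<noteq> n"
  shows "n \<in> hs_B c h"
proof -
  have "n \<in> hs_C c h"
    using assms by (auto simp: hs_edot_def hs_e_def restr_def split: if_splits)
  then show ?thesis
    by (auto simp: hs_C_def hs_T_def split: if_splits)
qed

lemma finite_agreement_hs_family_square:
  fixes p q :: "nat \<Rightarrow> seq"
  assumes "inj c"
    and lp: "\<And>n. length (p n) \<noteq> n" and lq: "\<And>n. length (q n) \<noteq> n"
    and pq: "\<And>n. p n \<noteq> q n"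
    and "f \<in> family_square (hs_family \<Phi> c)"
  shows "finite (agreement f (fun_prod p q))"
proof -
  obtain h1 h2 where
    f: "f = fun_prod (hs_edot \<Phi> h1 (hs_C c h1)) (hs_edot \<Phi> h2 (hs_C c h2))"
    using assms(5) by (auto simp: family_square_def hs_family_def)
  show ?thesis
  proof (cases "h1 = h2")
    case True
    then have "agreement f (fun_prod p q) = {}"
      using pq by (auto simp: f agreement_def fun_prod_def)
    then show ?thesis
      by simp
  next
    case False
    have "agreement f (fun_prod p q) \<subseteq> hs_B c h1 \<inter> hs_B c h2"
    proof
      fix n assume "n \<in> agreement f (fun_prod p q)"
      then have "hs_edot \<Phi> h1 (hs_C c h1) n = p n" "hs_edot \<Phi> h2 (hs_C c h2) n = q n"
        by (auto simp: f agreement_def fun_prod_def)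
      then show "n \<in> hs_B c h1 \<inter> hs_B c h2"
        using lp[of n] lq[of n] by (metis IntI hs_edot_length_neq_imp_mem_hs_B)
    qed
    then show ?thesis
      using finite_hs_B_inter[OF assms(1) False] by (rule finite_subset)
  qed
qed

theorem lemma4p2:
  fixes \<Phi> :: "(nat \<Rightarrow> seq) \<Rightarrow> (nat \<Rightarrow> nat)"
    and c :: "seq list \<Rightarrow> nat"
  assumes "bij \<Phi>"
    and "computable_from_seqs \<Phi>"
    and "computable_to_seqs (inv \<Phi>)"
    and "inj c"
    and "computable_coding c"
  shows "\<not> square_family (hs_family \<Phi> c) \<and> \<not> med_family (family_square (hs_family \<Phi> c))"
proof -
  define p q :: "nat \<Rightarrow> seq" where "p n = replicate (Suc n) 0" and "q n = replicate (Suc n) 1" for n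
  have "finite (agreement f (fun_prod p q))" if "f \<in> family_square (hs_family \<Phi> c)" for f
    using \<open>inj c\<close> _ _ _ that
    by (rule finite_agreement_hs_family_square) (simp_all add: p_def q_def)
  then have "\<not> med_family (family_square (hs_family \<Phi> c))"
    using med_family_meets_every_function[OF infinite_UNIV_nat] by blast
  then show ?thesis
    by (simp add: square_family_def)
qed

end
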